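(* Let $m,n\ge 1$ be integers, let $A\in\mathbb{Z}^{m\times n}$ and $b\in\mathbb{Z}^m$ satisfy $A_{ij}\ge 0$ and $b_i>0$ for all $i=1,\ldots,m$, $j=1,\ldots,n$, and let $Q=\{x\in\mathbb{R}^n : x\ge 0,\ Ax\le b\}$. Then the aggregation closure $$\mathcal{A}(Q)=\bigcap_{\lambda\in\mathbb{R}^m_+}\operatorname{conv}\{Q^\lambda\cap\mathbb{Z}^n\},\qquad Q^\lambda=\{x\in\mathbb{R}^n : x\ge 0,\ \lambda^TAx\le\lambda^Tb\},$$ is a polyhedron.
   Context: $\mathbb{R}^m_+$ denotes the set of vectors in $\mathbb{R}^m$ with nonnegative entries; inequalities between vectors are componentwise; $\operatorname{conv}$ denotes convex hull. The multipliers $\lambda$ are arbitrary nonnegative real vectors (not necessarily rational). A polyhedron is an intersection of finitely many closed halfspaces of $\mathbb{R}^n$. A packing integer program is one with feasible region $\{x\in\mathbb{Z}^n : x\ge0,\ Ax\le b\}$ with $A,b$ as in the claim. *)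

theory Defs
  imports "HOL-Analysis.Analysis"
begin

definition integer_points :: "(real ^ 'n) set"
  where "integer_points = {x. \<forall>j. x $ j \<in> \<int>}"

definition aggregated_relaxation ::
    "real ^ 'n ^ 'm \<Rightarrow> real ^ 'm \<Rightarrow> real ^ 'm \<Rightarrow> (real ^ 'n) set"
  where "aggregated_relaxation A b l = {x. 0 \<le> x \<and> (l v* A) \<bullet> x \<le> l \<bullet> b}"

text \<open>The aggregation closure of the polyhedron of all \<open>x \<ge> 0\<close> with \<open>A x \<le> b\<close>.
  It is determined by the constraint system, so it takes \<open>A\<close> and \<open>b\<close> as its arguments. The
  order on vectors is the componentwise one; \<open>l\<close> ranges over all nonnegative real vectors.\<close>

definition aggregation_closure :: "real ^ 'n ^ 'm \<Rightarrow> real ^ 'm \<Rightarrow> (real ^ 'n) set"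
  where "aggregation_closure A b =
    (\<Inter>l\<in>{l. 0 \<le> l}. convex hull (aggregated_relaxation A b l \<inter> integer_points))"

end

theory Submission
  imports Defs
begin

text \<open>After aggregation, the integer points form a set \<open>{x \<in> \<nat>\<^sup>n. a \<bullet> x \<le> \<beta>}\<close> with \<open>a \<ge> 0\<close>, which
  is downward closed in \<open>\<nat>\<^sup>n\<close> and is the product of a finite set with \<open>\<nat>\<^sup>J\<close>, where \<open>J\<close> is the zero
  set of \<open>a\<close>. There are finitely many \<open>J\<close>, and finite downward closed sets are well-quasi-ordered by
  inclusion. Hence finitely many of these sets are such that every other one contains one of them,
  and the closure is a finite intersection of hulls, each the sum of a polytope and an orthant.\<close>

section \<open>Finite down-sets are well-quasi-ordered by inclusion\<close>

text \<open>The sets are treated one after another, and refining a subsequence keeps the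
  monotonicity already gained. The hypothesis speaks of every subsequence \<open>q\<close> because
  each new set is met only after earlier thinning.\<close>

lemma common_mono_subsequence:
  fixes F :: "nat \<Rightarrow> 'a set"
  assumes "finite \<S>"
    and "\<And>S q. S \<in> \<S> \<Longrightarrow> strict_mono q \<Longrightarrow>
           \<exists>r::nat \<Rightarrow> nat. strict_mono r \<and> mono (\<lambda>k. F (q (r k)) \<inter> S)"
  shows "\<exists>r::nat \<Rightarrow> nat. strict_mono r \<and> (\<forall>S\<in>\<S>. mono (\<lambda>k. F (r k) \<inter> S))"
  using assms
proof (induction \<S> rule: finite_induct)
  case empty
  show ?case by (intro exI[of _ id]) (auto simp: strict_mono_def)
next
  case (insert S \<S>)
  then obtain q :: "nat \<Rightarrow> nat" where q: "strict_mono q" "\<forall>S\<in>\<S>. mono (\<lambda>k. F (q k) \<inter> S)"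
    by blast
  then obtain r :: "nat \<Rightarrow> nat" where r: "strict_mono r" "mono (\<lambda>k. F (q (r k)) \<inter> S)"
    using insert.prems by blast
  have "mono (\<lambda>k. F (q (r k)) \<inter> T)" if "T \<in> \<S>" for T
  proof (rule monoI)
    fix i j :: nat assume "i \<le> j"
    then have "r i \<le> r j" using r(1) by (simp add: strict_mono_less_eq)
    then show "F (q (r i)) \<inter> T \<subseteq> F (q (r j)) \<inter> T"
      using q(2) that by (auto simp: mono_def)
  qed
  moreover have "strict_mono (\<lambda>k. q (r k))"
    using q(1) r(1) by (simp add: strict_mono_def)
  ultimately show ?case
    using r(2) by (intro exI[of _ "\<lambda>k. q (r k)"]) auto
qed

text \<open>Induction on the number of coordinates that the slab leaves free. If some
  \<open>y\<close> of a slice is missing from infinitely many \<open>F j\<close>, down-closure bars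
  these from all points above \<open>y\<close>, and thinner slabs suffice. Otherwise each finite
  slice is contained in a later one.\<close>

lemma finite_downset_mono_subsequence:
  fixes F :: "nat \<Rightarrow> ('a::finite \<Rightarrow> nat) set" and c :: "'a \<Rightarrow> nat"
  assumes "\<And>k. finite (F k \<inter> {x. \<forall>i\<in>I. x i = c i})"
    and "\<And>k x y. x \<in> F k \<Longrightarrow> y \<le> x \<Longrightarrow> y \<in> F k"
  shows "\<exists>r::nat \<Rightarrow> nat. strict_mono r \<and> mono (\<lambda>k. F (r k) \<inter> {x. \<forall>i\<in>I. x i = c i})"
  using assms
proof (induction "card (- I)" arbitrary: I c F rule: less_induct)
  case less
  define S where "S = (\<lambda>I (c::'a \<Rightarrow> nat). {x. \<forall>i\<in>I. x i = c i})"
  have fin: "finite (F k \<inter> S I c)" for k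
    using less.prems(1) by (simp add: S_def)
  show ?case
  proof (cases "\<exists>k. \<exists>y\<in>F k \<inter> S I c. infinite {j. y \<notin> F j}")
    case True
    then obtain y where y: "y \<in> S I c" "infinite {j. y \<notin> F j}" by blast
    then obtain q :: "nat \<Rightarrow> nat" where q: "strict_mono q" "\<And>k. y \<notin> F (q k)"
      using infinite_enumerate by blast
    define \<S> where "\<S> = (\<Union>i\<in>-I. (\<lambda>v. S (insert i I) (c(i := v))) ` {..<y i})"
    \<comment> \<open>a point of the slab that is not above \<open>y\<close> lies in one of finitely many thinner slabs\<close>
    have cover: "\<exists>T\<in>\<S>. x \<in> T" if "x \<in> F (q k)" "x \<in> S I c" for x k
    proof -
      have "\<not> y \<le> x" using less.prems(2) q(2) that(1) by blast
      then obtain i where i: "x i < y i" by (auto simp: le_fun_def not_le)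
      \<comment> \<open>On \<open>I\<close> both \<open>x\<close> and \<open>y\<close> agree with
        \<open>c\<close>, so a coordinate where they differ is still free.\<close>
      then have "i \<in> - I" using that(2) y(1) by (auto simp: S_def)
      moreover have "x \<in> S (insert i I) (c(i := x i))"
        using that(2) \<open>i \<in> - I\<close> by (auto simp: S_def)
      ultimately show ?thesis using i by (auto simp: \<S>_def)
    qed
    have "\<exists>r::nat \<Rightarrow> nat. strict_mono r \<and> (\<forall>T\<in>\<S>. mono (\<lambda>k. F (q (r k)) \<inter> T))"
    proof (rule common_mono_subsequence)
      show "finite \<S>" by (auto simp: \<S>_def)
    next
      fix T and p :: "nat \<Rightarrow> nat" assume "T \<in> \<S>"
      then obtain i v where i: "i \<notin> I" and T: "T = S (insert i I) (c(i := v))"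
        by (auto simp: \<S>_def)
      have "- insert i I \<subset> - I" using i by auto
      then have "card (- insert i I) < card (- I)" by (intro psubset_card_mono) auto
      moreover have "T \<subseteq> S I c" using i by (auto simp: T S_def split: if_splits)
      then have "finite (F (q (p k)) \<inter> T)" for k
        using fin[of "q (p k)"] by (rule_tac finite_subset) auto
      ultimately show "\<exists>r::nat \<Rightarrow> nat. strict_mono r \<and> mono (\<lambda>k. F (q (p (r k))) \<inter> T)"
        using less.hyps[of "insert i I" "\<lambda>k. F (q (p k))" "c(i := v)"] less.prems(2)
        unfolding T S_def by blast
    qed
    then obtain r :: "nat \<Rightarrow> nat" where r: "strict_mono r"
      "\<And>T. T \<in> \<S> \<Longrightarrow> mono (\<lambda>k. F (q (r k)) \<inter> T)" by blast
    have "mono (\<lambda>k. F (q (r k)) \<inter> S I c)"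
    proof (rule monoI, rule subsetI)
      fix i j :: nat and x assume ij: "i \<le> j" and x: "x \<in> F (q (r i)) \<inter> S I c"
      then obtain T where T: "T \<in> \<S>" "x \<in> T" using cover by blast
      then have "x \<in> F (q (r j))" using monoD[OF r(2)[OF T(1)] ij] x by blast
      then show "x \<in> F (q (r j)) \<inter> S I c" using x by blast
    qed
    moreover have "strict_mono (\<lambda>k. q (r k))"
      using q(1) r(1) by (simp add: strict_mono_def)
    ultimately show ?thesis unfolding S_def by (intro exI[of _ "\<lambda>k. q (r k)"]) simp
  next
    case False
    have next_index: "\<exists>j>k. F k \<inter> S I c \<subseteq> F j" for k
    proof -
      \<comment> \<open>Every point of the finite slice is missing from only finitely many sets.
        Adding \<open>{..k}\<close> below forces the new index beyond \<open>k\<close>.\<close>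
      have "finite (\<Union>y\<in>F k \<inter> S I c. {j. y \<notin> F j})" using False fin by blast
      then have "finite ({..k} \<union> (\<Union>y\<in>F k \<inter> S I c. {j. y \<notin> F j}))" by simp
      then obtain j where "j \<notin> {..k} \<union> (\<Union>y\<in>F k \<inter> S I c. {j. y \<notin> F j})"
        using ex_new_if_finite[OF infinite_UNIV_nat] by blast
      then show ?thesis by (auto simp: not_le)
    qed
    have "\<exists>r. \<forall>n. True \<and> (r n < r (Suc n) \<and> F (r n) \<inter> S I c \<subseteq> F (r (Suc n)))"
      using dependent_nat_choice[of "\<lambda>_ _. True" "\<lambda>_ x y. x < y \<and> F x \<inter> S I c \<subseteq> F y"]
        next_index by auto
    then obtain r :: "nat \<Rightarrow> nat" where r: "\<And>n. r n < r (Suc n)"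
      "\<And>n. F (r n) \<inter> S I c \<subseteq> F (r (Suc n))" by blast
    have "strict_mono r" using r(1) by (simp add: strict_mono_Suc_iff)
    moreover have "mono (\<lambda>k. F (r k) \<inter> S I c)"
      unfolding mono_iff_le_Suc using r(2) by blast
    ultimately show ?thesis unfolding S_def by blast
  qed
qed

section \<open>Knapsack sets\<close>

text \<open>Lattice points are kept as functions into the naturals, where the pointwise order serves
  the subsequence argument; this embedding carries them to the vectors whose hulls are
  taken.\<close>

definition vec_of_nat :: "('n \<Rightarrow> nat) \<Rightarrow> real ^ 'n"
  where "vec_of_nat f = (\<chi> i. real (f i))"

definition knapsack :: "real ^ 'n \<Rightarrow> real \<Rightarrow> ('n \<Rightarrow> nat) set"
  where "knapsack a \<beta> = {f. a \<bullet> vec_of_nat f \<le> \<beta>}"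

text \<open>The coordinate projection along the span of the axes in \<open>J\<close>. With
  \<open>J\<close> the zero set of \<open>a\<close>, it removes the directions in which a knapsack
  set is unbounded for free.\<close>

definition zero_on :: "'n set \<Rightarrow> real ^ 'n \<Rightarrow> real ^ 'n"
  where "zero_on J x = (\<chi> i. if i \<in> J then 0 else x $ i)"

lemma linear_zero_on: "linear (zero_on J)"
  by (rule linearI) (auto simp: zero_on_def vec_eq_iff)

lemma range_vec_of_nat:
  "range vec_of_nat = {x::real ^ 'n. 0 \<le> x} \<inter> integer_points"
proof
  show "range vec_of_nat \<subseteq> {x::real ^ 'n. 0 \<le> x} \<inter> integer_points"
    by (auto simp: vec_of_nat_def integer_points_def less_eq_vec_def)
next
  show "{x::real ^ 'n. 0 \<le> x} \<inter> integer_points \<subseteq> range vec_of_nat"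
  proof
    fix x :: "real ^ 'n" assume x: "x \<in> {x. 0 \<le> x} \<inter> integer_points"
    have "real (nat \<lfloor>x $ i\<rfloor>) = x $ i" for i
    proof -
      have "x $ i \<in> \<int>" "0 \<le> x $ i" using x by (auto simp: integer_points_def less_eq_vec_def)
      then show ?thesis by (auto elim!: Ints_cases)
    qed
    then have "x = vec_of_nat (\<lambda>i. nat \<lfloor>x $ i\<rfloor>)" by (simp add: vec_of_nat_def vec_eq_iff)
    then show "x \<in> range vec_of_nat" by blast
  qed
qed

lemma knapsack_downset:
  assumes "0 \<le> a" "x \<in> knapsack a \<beta>" "y \<le> x"
  shows "y \<in> knapsack a \<beta>"
proof -
  have "a \<bullet> vec_of_nat y \<le> a \<bullet> vec_of_nat x"
    unfolding inner_vec_def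
    by (rule sum_mono) (use assms in \<open>auto simp: vec_of_nat_def less_eq_vec_def le_fun_def
      intro!: mult_left_mono\<close>)
  then show ?thesis using assms(2) by (simp add: knapsack_def)
qed

lemma knapsack_cong_support:
  assumes "\<And>i. a $ i \<noteq> 0 \<Longrightarrow> x i = y i"
  shows "x \<in> knapsack a \<beta> \<longleftrightarrow> y \<in> knapsack a \<beta>"
proof -
  have "a \<bullet> vec_of_nat x = a \<bullet> vec_of_nat y"
    unfolding inner_vec_def by (rule sum.cong) (use assms in \<open>auto simp: vec_of_nat_def\<close>)
  then show ?thesis by (simp add: knapsack_def)
qed

text \<open>A positive coefficient bounds its coordinate by \<open>\<beta> / a $ i\<close>, since
  the other summands are nonnegative; the remaining coordinates are held at 0.\<close>

lemma finite_knapsack_slice: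
  fixes a :: "real ^ 'n"
  assumes "0 \<le> a"
  shows "finite (knapsack a \<beta> \<inter> {x. \<forall>i\<in>{i. a $ i = 0}. x i = 0})"
proof (rule finite_subset)
  show "finite (Pi\<^sub>E UNIV (\<lambda>i::'n. {..nat \<lfloor>\<beta> / a $ i\<rfloor>}))"
    by (rule finite_PiE) auto
  show "knapsack a \<beta> \<inter> {x. \<forall>i\<in>{i. a $ i = 0}. x i = 0} \<subseteq> Pi\<^sub>E UNIV (\<lambda>i::'n. {..nat \<lfloor>\<beta> / a $ i\<rfloor>})"
  proof
    fix x assume x: "x \<in> knapsack a \<beta> \<inter> {x. \<forall>i\<in>{i. a $ i = 0}. x i = 0}"
    have "x i \<le> nat \<lfloor>\<beta> / a $ i\<rfloor>" for i
    proof (cases "a $ i = 0")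
      case True
      then show ?thesis using x by simp
    next
      case False
      then have pos: "0 < a $ i" using assms by (simp add: less_eq_vec_def less_le)
      have "a $ i * real (x i) \<le> (\<Sum>i\<in>UNIV. a $ i * real (x i))"
        by (rule member_le_sum) (use assms in \<open>auto simp: less_eq_vec_def\<close>)
      also have "\<dots> \<le> \<beta>" using x by (simp add: knapsack_def inner_vec_def vec_of_nat_def)
      finally have "real (x i) \<le> \<beta> / a $ i" using pos by (simp add: field_simps)
      then show ?thesis by (simp add: le_nat_iff le_floor_iff)
    qed
    then show "x \<in> Pi\<^sub>E UNIV (\<lambda>i. {..nat \<lfloor>\<beta> / a $ i\<rfloor>})" by (auto simp: PiE_def)
  qed
qed

text \<open>Coordinates in the common zero set affect neither inequality, so they can be reset to 0
  before the comparison and restored after it.\<close>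

lemma knapsack_subset_if_slice_subset:
  fixes a a' :: "real ^ 'n"
  defines "S \<equiv> \<lambda>a::real ^ 'n. {x. \<forall>i\<in>{i. a $ i = 0}. x i = (0::nat)}"
  assumes "0 \<le> a" and "{i. a $ i = 0} = {i. a' $ i = 0}"
    and "knapsack a \<beta> \<inter> S a \<subseteq> knapsack a' \<beta>' \<inter> S a"
  shows "knapsack a \<beta> \<subseteq> knapsack a' \<beta>'"
proof
  fix x assume x: "x \<in> knapsack a \<beta>"
  define y where "y = (\<lambda>i. if a $ i = 0 then 0 else x i)"
  have "y \<in> knapsack a \<beta>" using x knapsack_cong_support[of a y x \<beta>] by (simp add: y_def)
  moreover have "y \<in> S a" by (simp add: S_def y_def)
  ultimately have "y \<in> knapsack a' \<beta>'" using assms(4) by blast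
  moreover have "a' $ i \<noteq> 0 \<Longrightarrow> y i = x i" for i using assms(3) by (auto simp: y_def)
  ultimately show "x \<in> knapsack a' \<beta>'" using knapsack_cong_support by blast
qed

text \<open>By pigeonhole one zero set occurs infinitely often. Along those indices the slices are
  finite down-sets, so a subsequence of them increases, and its first two terms give the
  pair.\<close>

lemma no_bad_knapsack_sequence:
  fixes w :: "nat \<Rightarrow> (real ^ 'n) \<times> real"
  assumes "\<And>k. 0 \<le> fst (w k)"
  shows "\<exists>i j. i < j \<and> knapsack (fst (w i)) (snd (w i)) \<subseteq> knapsack (fst (w j)) (snd (w j))"
proof -
  let ?Z = "\<lambda>k. {i. fst (w k) $ i = 0}"
  have "finite (range ?Z)" by (rule finite_subset[of _ UNIV]) auto
  then obtain k0 where "infinite {k. ?Z k = ?Z k0}"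
    using pigeonhole_infinite[of UNIV ?Z] by auto
  then obtain q :: "nat \<Rightarrow> nat" where q: "strict_mono q" "\<And>k. ?Z (q k) = ?Z k0"
    using infinite_enumerate[of "{k. ?Z k = ?Z k0}"] by blast
  define F where "F = (\<lambda>k. knapsack (fst (w (q k))) (snd (w (q k))))"
  have "\<exists>r::nat \<Rightarrow> nat. strict_mono r \<and> mono (\<lambda>k. F (r k) \<inter> {x. \<forall>i\<in>?Z k0. x i = 0})"
  proof (rule finite_downset_mono_subsequence)
    show "finite (F k \<inter> {x. \<forall>i\<in>?Z k0. x i = 0})" for k
      using finite_knapsack_slice[OF assms, of "q k"] unfolding q(2) F_def by blast
  qed (use knapsack_downset[OF assms] in \<open>auto simp: F_def\<close>)
  then obtain r :: "nat \<Rightarrow> nat" where r: "strict_mono r"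
    "mono (\<lambda>k. F (r k) \<inter> {x. \<forall>i\<in>?Z k0. x i = 0})" by blast
  have "F (r 0) \<inter> {x. \<forall>i\<in>?Z k0. x i = 0} \<subseteq> F (r 1) \<inter> {x. \<forall>i\<in>?Z k0. x i = 0}"
    using monoD[OF r(2), of 0 1] by simp
  then have "F (r 0) \<subseteq> F (r 1)"
    unfolding F_def
    by (intro knapsack_subset_if_slice_subset) (use assms q(2) in \<open>simp_all only: q(2)\<close>)
  moreover have "q (r 0) < q (r 1)" using q(1) r(1) by (simp add: strict_mono_def)
  ultimately show ?thesis unfolding F_def by blast
qed

text \<open>Without such a \<open>G\<close>, no finite selection suffices, so one can forever pick a
  member of \<open>W\<close> whose knapsack set contains none of the earlier ones. This would be a
  bad sequence.\<close>

lemma finite_knapsack_basis: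
  fixes W :: "((real ^ 'n) \<times> real) set"
  assumes "\<And>w. w \<in> W \<Longrightarrow> 0 \<le> fst w"
  shows "\<exists>G\<subseteq>W. finite G \<and>
           (\<forall>w\<in>W. \<exists>g\<in>G. knapsack (fst g) (snd g) \<subseteq> knapsack (fst w) (snd w))"
proof (rule ccontr)
  let ?K = "\<lambda>w::(real ^ 'n) \<times> real. knapsack (fst w) (snd w)"
  assume *: "\<not> ?thesis"
  have "\<exists>w. \<forall>k::nat. w k \<in> W \<and> (\<forall>i<k. \<not> ?K (w i) \<subseteq> ?K (w k))"
  proof (rule dependent_wellorder_choice)
    fix k :: nat and w :: "nat \<Rightarrow> (real ^ 'n) \<times> real"
    assume "\<And>j. j < k \<Longrightarrow> w j \<in> W \<and> (\<forall>i<j. \<not> ?K (w i) \<subseteq> ?K (w j))"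
    then have "w ` {..<k} \<subseteq> W" "finite (w ` {..<k})" by auto
    with * have "\<not> (\<forall>v\<in>W. \<exists>g\<in>w ` {..<k}. ?K g \<subseteq> ?K v)" by meson
    then show "\<exists>v. v \<in> W \<and> (\<forall>i<k. \<not> ?K (w i) \<subseteq> ?K v)"
      unfolding bex_simps ball_simps by (meson imageI lessThan_iff)
  qed auto
  then obtain w where w: "\<And>k::nat. w k \<in> W" "\<And>i k. i < k \<Longrightarrow> \<not> ?K (w i) \<subseteq> ?K (w k)" by blast
  have "0 \<le> fst (w k)" for k using assms w(1) .
  then show False using no_bad_knapsack_sequence[of w] w(2) by blast
qed

section \<open>Integer hulls of knapsack sets\<close>

lemma polyhedron_linear_vimage:
  fixes f :: "'a::euclidean_space \<Rightarrow> 'b::euclidean_space"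
  assumes "linear f" "polyhedron S"
  shows "polyhedron (f -` S)"
proof -
  obtain F where F: "finite F" "S = \<Inter>F" "\<forall>h\<in>F. \<exists>a b. a \<noteq> 0 \<and> h = {x. a \<bullet> x \<le> b}"
    using assms(2) by (auto simp: polyhedron_def)
  have "polyhedron (f -` h)" if h: "h \<in> F" for h
  proof -
    obtain a b where "h = {x. a \<bullet> x \<le> b}" using F(3) h by meson
    \<comment> \<open>The adjoint may send \<open>a\<close> to 0; the preimage is then empty or
      everything, still a polyhedron.\<close>
    then have "f -` h = {x. adjoint f a \<bullet> x \<le> b}"
      using adjoint_works[OF assms(1)] by (auto simp: inner_commute)
    then show ?thesis by (simp add: polyhedron_halfspace_le)
  qed
  moreover have "f -` S = \<Inter>((\<lambda>h. f -` h) ` F)" by (auto simp: F(2))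
  ultimately show ?thesis using F(1) by auto
qed

lemma polyhedron_nonneg_orthant: "polyhedron {x::real ^ 'n. 0 \<le> x}"
proof -
  have "{x::real ^ 'n. 0 \<le> x} = \<Inter>(range (\<lambda>i. {x. axis i 1 \<bullet> x \<ge> 0}))"
    by (auto simp: less_eq_vec_def inner_axis')
  then show ?thesis by (auto intro!: polyhedron_Inter polyhedron_halfspace_ge)
qed

text \<open>Coordinates are rounded one at a time: a point lies on the segment between its two
  roundings in that coordinate. The induction runs over a set \<open>K\<close> outside which all
  coordinates are integers.\<close>

lemma nonneg_in_convex_hull_nat:
  fixes x :: "real ^ 'n"
  assumes "0 \<le> x" and "\<And>i. i \<notin> J \<Longrightarrow> x $ i = 0"
  shows "x \<in> convex hull (vec_of_nat ` {f. \<forall>i. i \<notin> J \<longrightarrow> f i = 0})"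
proof -
  let ?N = "vec_of_nat ` {f. \<forall>i. i \<notin> J \<longrightarrow> f i = 0} :: (real ^ 'n) set"
  have "x \<in> convex hull ?N"
    if "finite K" "0 \<le> x" "\<And>i. i \<notin> J \<Longrightarrow> x $ i = 0" "\<And>i. i \<notin> K \<Longrightarrow> x $ i \<in> \<int>"
    for K and x :: "real ^ 'n"
    using that
  proof (induction K arbitrary: x rule: finite_induct)
    case empty
    then have "x \<in> range vec_of_nat"
      unfolding range_vec_of_nat by (simp add: integer_points_def)
    then obtain f where f: "x = vec_of_nat f" by blast
    have "f i = 0" if "i \<notin> J" for i
      using empty.prems(2)[OF that] by (simp add: f vec_of_nat_def)
    then show ?case using f by (intro hull_inc) blast
  next
    case (insert k K)
    define y where "y = (\<lambda>v. \<chi> i. if i = k then v else x $ i)"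
    show ?case
    proof (cases "k \<in> J")
      case True
      have x0: "0 \<le> x $ i" for i using insert.prems(1) by (simp add: less_eq_vec_def)
      have y: "y v \<in> convex hull ?N" if "0 \<le> v" "v \<in> \<int>" for v
        using insert.prems True that x0
        by (intro insert.IH) (auto simp: y_def less_eq_vec_def)
      \<comment> \<open>The fractional part is the weight of the upper neighbour. Taking floor plus
        1 instead of the ceiling keeps the formula valid at integers, where \<open>t\<close> is
        0.\<close>
      define t where "t = frac (x $ k)"
      have "x = (1 - t) *\<^sub>R y \<lfloor>x $ k\<rfloor> + t *\<^sub>R y (\<lfloor>x $ k\<rfloor> + 1)"
        by (simp add: vec_eq_iff y_def t_def frac_def algebra_simps)
      moreover have "0 \<le> t" "t \<le> 1"
        using frac_lt_1[of "x $ k"] by (auto simp: t_def intro: less_imp_le)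
      moreover have "y \<lfloor>x $ k\<rfloor> \<in> convex hull ?N" "y (\<lfloor>x $ k\<rfloor> + 1) \<in> convex hull ?N"
        using x0[of k] by (auto intro!: y)
      ultimately show ?thesis
        using convexD[OF convex_convex_hull, of "y \<lfloor>x $ k\<rfloor>" ?N "y (\<lfloor>x $ k\<rfloor> + 1)" "1 - t" t]
        by simp
    next
      case False
      \<comment> \<open>Outside \<open>J\<close> the coordinate is 0, hence already an integer, and
        \<open>K\<close> needs no rounding at \<open>k\<close>.\<close>
      then have int: "x $ i \<in> \<int>" if "i \<notin> K" for i
        using insert.prems(2,3)[of i] that by (cases "i = k") auto
      show ?thesis by (rule insert.IH) (use insert.prems(1,2) int in blast)+
    qed
  qed
  from this[of UNIV x] assms show ?thesis by simp
qed

text \<open>\<open>D\<close> absorbs the addition of natural vectors supported on \<open>J\<close>,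
  and the hull of those is the orthant on \<open>J\<close>. Writing the resulting sum as a linear
  preimage cut by the orthant reduces polyhedrality to preimages and intersections.\<close>

lemma convex_hull_knapsack:
  fixes a :: "real ^ 'n" and \<beta> :: real
  defines "J \<equiv> {i. a $ i = 0}"
  defines "D \<equiv> vec_of_nat ` knapsack a \<beta>"
  shows "convex hull D = {x. 0 \<le> x} \<inter> zero_on J -` (convex hull (zero_on J ` D))"
proof
  show "convex hull D \<subseteq> {x. 0 \<le> x} \<inter> zero_on J -` (convex hull (zero_on J ` D))"
  proof (rule hull_minimal)
    show "D \<subseteq> {x. 0 \<le> x} \<inter> zero_on J -` (convex hull (zero_on J ` D))"
      by (auto simp: D_def vec_of_nat_def less_eq_vec_def intro: hull_inc)
    show "convex ({x. 0 \<le> x} \<inter> zero_on J -` (convex hull (zero_on J ` D)))"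
      by (intro convex_Int convex_linear_vimage linear_zero_on convex_convex_hull
          polyhedron_imp_convex polyhedron_nonneg_orthant)
  qed
next
  let ?N = "vec_of_nat ` {f. \<forall>i. i \<notin> J \<longrightarrow> f i = 0} :: (real ^ 'n) set"
  show "{x. 0 \<le> x} \<inter> zero_on J -` (convex hull (zero_on J ` D)) \<subseteq> convex hull D"
  proof
    fix x assume x: "x \<in> {x. 0 \<le> x} \<inter> zero_on J -` (convex hull (zero_on J ` D))"
    have "x - zero_on J x \<in> convex hull ?N"
      by (rule nonneg_in_convex_hull_nat) (use x in \<open>auto simp: zero_on_def less_eq_vec_def\<close>)
    moreover have "zero_on J x \<in> convex hull (zero_on J ` D)" using x by simp
    \<comment> \<open>The hull of a Minkowski sum is the sum of the hulls.\<close>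
    ultimately have "zero_on J x + (x - zero_on J x) \<in> convex hull (zero_on J ` D + ?N)"
      unfolding convex_hull_set_plus by (rule set_plus_intro[rotated])
    moreover have "zero_on J ` D + ?N \<subseteq> D"
    proof
      fix z assume "z \<in> zero_on J ` D + ?N"
      then obtain f g where f: "f \<in> knapsack a \<beta>" and g: "\<forall>i. i \<notin> J \<longrightarrow> g i = 0"
        and z: "z = zero_on J (vec_of_nat f) + vec_of_nat g"
        by (auto simp: D_def set_plus_def)
      define h where "h = (\<lambda>i. if i \<in> J then g i else f i)"
      have "z = vec_of_nat h"
        using g by (auto simp: z h_def vec_of_nat_def zero_on_def vec_eq_iff)
      moreover have "h \<in> knapsack a \<beta>"
        using f knapsack_cong_support[of a h f \<beta>] by (simp add: h_def J_def)
      ultimately show "z \<in> D" by (simp add: D_def)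
    qed
    then have "convex hull (zero_on J ` D + ?N) \<subseteq> convex hull D" by (rule hull_mono)
    ultimately show "x \<in> convex hull D" by auto
  qed
qed

text \<open>The projected points already lie in the finite slice, so their hull is a
  polytope.\<close>

lemma polyhedron_convex_hull_knapsack:
  fixes a :: "real ^ 'n"
  assumes "0 \<le> a"
  shows "polyhedron (convex hull (vec_of_nat ` knapsack a \<beta>))"
proof -
  let ?J = "{i. a $ i = 0}"
  let ?D = "vec_of_nat ` knapsack a \<beta>"
  have "zero_on ?J ` ?D \<subseteq> vec_of_nat ` (knapsack a \<beta> \<inter> {x. \<forall>i\<in>?J. x i = 0})"
  proof (rule image_subsetI)
    fix z assume "z \<in> ?D"
    then obtain f where f: "f \<in> knapsack a \<beta>" "z = vec_of_nat f" by blast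
    define h where "h = (\<lambda>i. if i \<in> ?J then 0 else f i)"
    have "zero_on ?J z = vec_of_nat h"
      by (auto simp: f(2) h_def vec_of_nat_def zero_on_def vec_eq_iff)
    moreover have "h \<in> knapsack a \<beta>"
      using f(1) knapsack_cong_support[of a h f \<beta>] by (simp add: h_def)
    ultimately show "zero_on ?J z \<in> vec_of_nat ` (knapsack a \<beta> \<inter> {x. \<forall>i\<in>?J. x i = 0})"
      by (auto simp: h_def)
  qed
  then have "finite (zero_on ?J ` ?D)"
    using finite_knapsack_slice[OF assms] finite_subset by blast
  then show ?thesis
    unfolding convex_hull_knapsack
    by (intro polyhedron_Int polyhedron_nonneg_orthant polyhedron_linear_vimage linear_zero_on
        polyhedron_convex_hull)
qed

text \<open>Hulls respect inclusion, so the finite basis yields the same intersection as all of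
  \<open>W\<close>, however large.\<close>

lemma polyhedron_Inter_convex_hull_knapsack:
  fixes W :: "((real ^ 'n) \<times> real) set"
  assumes "\<And>w. w \<in> W \<Longrightarrow> 0 \<le> fst w"
  shows "polyhedron (\<Inter>(a, \<beta>)\<in>W. convex hull (vec_of_nat ` knapsack a \<beta>))"
proof -
  let ?H = "\<lambda>w::(real ^ 'n) \<times> real. convex hull (vec_of_nat ` knapsack (fst w) (snd w))"
  obtain G where G: "G \<subseteq> W" "finite G"
    "\<And>w. w \<in> W \<Longrightarrow> \<exists>g\<in>G. knapsack (fst g) (snd g) \<subseteq> knapsack (fst w) (snd w)"
    using finite_knapsack_basis[of W] assms by blast
  have "\<exists>g\<in>G. ?H g \<subseteq> ?H w" if "w \<in> W" for w
    using G(3)[OF that] by (meson hull_mono image_mono)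
  then have "(\<Inter>w\<in>W. ?H w) = (\<Inter>w\<in>G. ?H w)" using G(1) by blast
  moreover have "polyhedron (\<Inter>w\<in>G. ?H w)"
  proof (rule polyhedron_Inter)
    fix S assume "S \<in> ?H ` G"
    then obtain w where w: "w \<in> W" "S = ?H w" using G(1) by blast
    show "polyhedron S" unfolding w(2)
      by (rule polyhedron_convex_hull_knapsack[OF assms[OF w(1)]])
  qed (use G(2) in simp)
  ultimately show ?thesis by (simp add: case_prod_beta)
qed

section \<open>The aggregation closure as an intersection of knapsack hulls\<close>

theorem theorem1:
  fixes A :: "int ^ 'n ^ 'm" and b :: "int ^ 'm"
  assumes "\<And>i j. 0 \<le> A $ i $ j"
    and "\<And>i. 0 < b $ i"
  shows "polyhedron (aggregation_closure (\<chi> i j. real_of_int (A $ i $ j)) (\<chi> i. real_of_int (b $ i)))"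
proof -
  let ?A = "\<chi> i j. real_of_int (A $ i $ j)" and ?b = "\<chi> i. real_of_int (b $ i)"
  \<comment> \<open>A multiplier matters only through its aggregated row and right-hand side, so
    real multipliers just index a possibly infinite family of such pairs.\<close>
  let ?W = "(\<lambda>l. (l v* ?A, l \<bullet> ?b)) ` {l. 0 \<le> l}"
  have "aggregated_relaxation ?A ?b l \<inter> integer_points = vec_of_nat ` knapsack (l v* ?A) (l \<bullet> ?b)"
    for l
  proof -
    have "aggregated_relaxation ?A ?b l \<inter> integer_points =
      {x. (l v* ?A) \<bullet> x \<le> l \<bullet> ?b} \<inter> range vec_of_nat"
      unfolding range_vec_of_nat aggregated_relaxation_def by blast
    then show ?thesis by (auto simp: knapsack_def)
  qed
  then have "aggregation_closure ?A ?b = (\<Inter>(a, \<beta>)\<in>?W. convex hull (vec_of_nat ` knapsack a \<beta>))"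
    by (simp add: aggregation_closure_def)
  moreover have "0 \<le> fst w" if "w \<in> ?W" for w
    using that assms(1)
    by (auto simp: less_eq_vec_def vector_matrix_mult_def intro!: sum_nonneg)
  ultimately show ?thesis
    using polyhedron_Inter_convex_hull_knapsack[of ?W] by presburger
qed

end
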